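(* Let $p\ge 3$ be a prime, $m\ge 1$ an integer, $n=p^m$ and $\alpha\in[0,1]$. Put $$x=(1+\alpha)p^m-2p^{m-1}-1,\qquad y=\sqrt{\left(1-p^m+\alpha p^m\right)^2+4(1-\alpha)p^{m-1}}.$$ Then the spectrum of $A_\alpha(G_n)$, where $G_n$ is the unitary addition Cayley graph of order $n$, consists of the following eigenvalues with the following multiplicities (if some of the listed values coincide, multiplicities are added; a value listed with multiplicity $0$ is omitted): - $p^{m-1}(p\alpha-1)-1$ with multiplicity $\frac{p-3}{2}$; - $\frac{x-y}{2}$ with multiplicity $1$; - $p^{m-1}(p-1)\alpha-1$ with multiplicity $(p-1)(p^{m-1}-1)$; - $\alpha(p^m-p^{m-1})$ with multiplicity $p^{m-1}-1$; - $p^{m-1}\left((p-2)\alpha+1\right)-1$ with multiplicity $\frac{p-1}{2}$; - $\frac{x+y}{2}$ with multiplicity $1$.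
   Context: For an integer $n>1$, the unitary addition Cayley graph $G_n$ is the simple undirected graph with vertex set $\mathbb{Z}_n=\{0,1,\dots,n-1\}$ in which two distinct vertices $a,b$ are adjacent if and only if $a+b$ is a unit of the ring $\mathbb{Z}_n$, i.e. $\gcd(a+b,n)=1$ (no loops). For a simple graph $G$ with adjacency matrix $A(G)$ and diagonal matrix of vertex degrees $D(G)$, and $\alpha\in[0,1]$, the $A_\alpha$-matrix is $A_\alpha(G)=\alpha D(G)+(1-\alpha)A(G)$. Its $A_\alpha$-spectrum is the multiset of eigenvalues of $A_\alpha(G)$. *)

theory Defs
  imports
    "Graph_Theory.Pair_Digraph"
    "Jordan_Normal_Form.Char_Poly"
    "HOL-Number_Theory.Residues"
begin

text \<open>
  A simple undirected graph is a pair digraph satisfying \<^locale>\<open>pair_graph\<close>: finite, loop-free,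
  and with each edge \<open>{a, b}\<close> present as both arcs \<open>(a, b)\<close> and \<open>(b, a)\<close>.  The degree of a vertex
  is therefore its \<^const>\<open>out_degree\<close>.
\<close>

definition unitary_addition_Cayley_graph :: "nat \<Rightarrow> nat pair_pre_digraph" where
  "unitary_addition_Cayley_graph n =
     \<lparr>pverts = {0..<n},
      parcs = {(a, b). a < n \<and> b < n \<and> a \<noteq> b \<and> gcd (a + b) n = 1}\<rparr>"

lemma pair_graph_unitary_addition_Cayley_graph:
  "pair_graph (unitary_addition_Cayley_graph n)"
proof -
  have "finite (parcs (unitary_addition_Cayley_graph n))"
    by (rule finite_subset[of _ "{0..<n} \<times> {0..<n}"])
      (auto simp: unitary_addition_Cayley_graph_def)
  then show ?thesis
    by unfold_locales
      (auto simp: unitary_addition_Cayley_graph_def arcs_ends_def arc_to_ends_def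
        symmetric_def sym_def add.commute)
qed

lemma gcd_eq_1_iff_Units_residue_ring:
  assumes "n > 1"
  shows "gcd (a + b) n = 1 \<longleftrightarrow> int ((a + b) mod n) \<in> Units (residue_ring (int n))"
proof -
  interpret residues "int n" "residue_ring (int n)"
    by unfold_locales (use assms in auto)
  have "int ((a + b) mod n) \<in> Units (residue_ring (int n)) \<longleftrightarrow> coprime ((a + b) mod n) n"
    using assms by (auto simp: res_units_eq of_nat_mod[symmetric] simp del: of_nat_mod
        intro!: Nat.gr0I)
  then show ?thesis
    using assms by (simp add: coprime_iff_gcd_eq_1)
qed

text \<open>
  The following matrices are meant for graphs whose vertex set is \<open>{0..<n}\<close>; row and column \<open>i\<close>
  belong to vertex \<open>i\<close>.
\<close>

definition adjacency_mat :: "nat pair_pre_digraph \<Rightarrow> real mat" where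
  "adjacency_mat G = mat (card (pverts G)) (card (pverts G))
     (\<lambda>(i, j). if (i, j) \<in> parcs G then 1 else 0)"

definition degree_mat :: "nat pair_pre_digraph \<Rightarrow> real mat" where
  "degree_mat G = mat (card (pverts G)) (card (pverts G))
     (\<lambda>(i, j). if i = j then real (out_degree (with_proj G) i) else 0)"

definition A_alpha_mat :: "real \<Rightarrow> nat pair_pre_digraph \<Rightarrow> real mat" where
  "A_alpha_mat \<alpha> G = \<alpha> \<cdot>\<^sub>m degree_mat G + (1 - \<alpha>) \<cdot>\<^sub>m adjacency_mat G"

text \<open>
  Each eigenvalue is counted with its multiplicity as a root of the characteristic polynomial.
  For a simple graph the matrix is real symmetric, so all its complex eigenvalues are real and
  this agrees with the geometric multiplicity.
\<close>

definition A_alpha_spectrum :: "real \<Rightarrow> nat pair_pre_digraph \<Rightarrow> real multiset" where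
  "A_alpha_spectrum \<alpha> G = proots (char_poly (A_alpha_mat \<alpha> G))"

lemma set_mset_A_alpha_spectrum:
  "set_mset (A_alpha_spectrum \<alpha> G) = {k. eigenvalue (A_alpha_mat \<alpha> G) k}"
proof -
  have A: "A_alpha_mat \<alpha> G \<in> carrier_mat (card (pverts G)) (card (pverts G))"
    by (simp add: A_alpha_mat_def adjacency_mat_def degree_mat_def)
  have "char_poly (A_alpha_mat \<alpha> G) \<noteq> 0"
    using degree_monic_char_poly[OF A] by auto
  then show ?thesis
    by (simp add: A_alpha_spectrum_def eigenvalue_root_char_poly[OF A])
qed

end

theory Submission
  imports Defs
begin

text \<open>
  Put \<open>q = p ^ (m - 1)\<close>, so that \<open>n = p * q\<close>.  A number is a unit modulo \<open>n\<close> iff \<open>p\<close> does not divide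
  it.  Hence whether two distinct vertices are adjacent depends only on their residues modulo \<open>p\<close>,
  and the residue \<open>r\<close> is joined to all residues except \<open>-r\<close>.  All entries of the matrix thus come
  from the rule ``\<open>c\<close> if \<open>p\<close> does not divide \<open>a + b\<close>'', corrected on the diagonal by one of two
  numbers \<open>u\<close>, \<open>v\<close> according to whether \<open>p\<close> divides \<open>a\<close>
  (\<open>A_alpha_mat_unitary_addition_Cayley_graph\<close>); here \<open>c = 1 - \<alpha>\<close>, and \<open>v = u - 1\<close> since a vertex
  \<open>a\<close> with \<open>p\<close> not dividing \<open>2 * a\<close> loses itself as a neighbour.

  Acting on row vectors, such a matrix has these invariant directions.  Two vertices
  with the same residue give an eigenvector \<open>e\<^sub>a - e\<^sub>b\<close>, with eigenvalue \<open>u\<close> or \<open>v\<close>.  Modulo these, only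
  the \<open>p\<close> residues matter, and there the matrix is \<open>c * q\<close> times (all ones minus the permutation
  \<open>r \<mapsto> -r\<close>) plus a diagonal.  Differences \<open>e\<^sub>r - e\<^bsub>-r\<^esub>\<close> are antisymmetric and give \<open>v + c * q\<close>;
  differences of two orbits \<open>{r, -r}\<close> of nonzero residues give \<open>v - c * q\<close>.  What remains is a two-dimensional
  quotient spanned by the zero residue and the nonzero ones, whose quadratic characteristic
  polynomial has the roots \<open>(x - y) / 2\<close> and \<open>(x + y) / 2\<close>.

  Since eigenvalues may coincide for special \<open>\<alpha>\<close>, multiplicities are not obtained by counting
  eigenvectors but from a triangular form.  Arrange the
  vertices in a forest with roots \<open>0\<close> and \<open>1\<close>: every other vertex is attached to a smaller one
  such that ``vertex minus parent'' is one of the directions above up to differences of larger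
  vertices.  In the basis of these differences the matrix is upper triangular apart from a \<open>2 \<times> 2\<close> corner, and its entries are
  differences of partial row sums over subtrees (\<open>char_poly_forest_basis\<close>).  All subtrees that
  contain more than one vertex are unions of residue classes, for which row sums are immediate
  (\<open>row_sum_nonmultiples\<close>).
\<close>

section \<open>Characteristic polynomials after a forest change of basis\<close>

lemma det_2x2:
  fixes A :: "'a :: comm_ring_1 mat"
  assumes "A \<in> carrier_mat 2 2"
  shows "det A = A $$ (0, 0) * A $$ (1, 1) - A $$ (0, 1) * A $$ (1, 0)"
  using assms laplace_expansion_row[OF assms, of 0]
  by (simp add: numeral_2_eq_2 cofactor_def mat_delete_def det_single)

lemma char_poly_2x2:
  fixes A :: "'a :: comm_ring_1 mat"
  assumes "A \<in> carrier_mat 2 2"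
  shows "char_poly A = [: A $$ (0, 0) * A $$ (1, 1) - A $$ (0, 1) * A $$ (1, 0),
    - (A $$ (0, 0) + A $$ (1, 1)), 1 :]"
  using assms by (simp add: char_poly_def det_2x2) (simp add: char_poly_matrix_def algebra_simps)

lemma char_poly_four_block_lower_left_zero:
  fixes A B D :: "'a :: idom mat"
  assumes A: "A \<in> carrier_mat k k" and B: "B \<in> carrier_mat k l" and D: "D \<in> carrier_mat l l"
  shows "char_poly (four_block_mat A B (0\<^sub>m l k) D) = char_poly A * char_poly D"
proof -
  let ?B = "map_mat (\<lambda>a. [:- a:]) B"
  have "char_poly_matrix (four_block_mat A B (0\<^sub>m l k) D)
      = four_block_mat (char_poly_matrix A) ?B (0\<^sub>m l k) (char_poly_matrix D)"
    by (rule eq_matI) (use A B D in \<open>auto simp: char_poly_matrix_def one_poly_def\<close>)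
  moreover have "det (four_block_mat (char_poly_matrix A) ?B (0\<^sub>m l k) (char_poly_matrix D))
      = det (char_poly_matrix A) * det (char_poly_matrix D)"
    by (rule det_four_block_mat_lower_left_zero[OF _ _ refl]) (use A B D in auto)
  ultimately show ?thesis
    by (simp add: char_poly_def)
qed

lemma char_poly_upper_triangular_below_corner:
  fixes T :: "'a :: idom mat"
  assumes T: "T \<in> carrier_mat n n" and "k \<le> n"
    and zero: "\<And>i j. k \<le> i \<Longrightarrow> i < n \<Longrightarrow> j < i \<Longrightarrow> T $$ (i, j) = 0"
  shows "char_poly T = char_poly (mat k k (($$) T)) * (\<Prod>i = k..<n. [:- (T $$ (i, i)), 1:])"
proof -
  define B where "B = mat k (n - k) (\<lambda>(i, j). T $$ (i, j + k))"
  define D where "D = mat (n - k) (n - k) (\<lambda>(i, j). T $$ (i + k, j + k))"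
  have blocks: "T = four_block_mat (mat k k (($$) T)) B (0\<^sub>m (n - k) k) D"
    by (rule eq_matI) (use T \<open>k \<le> n\<close> zero in \<open>auto simp: B_def D_def\<close>)
  have "upper_triangular D"
    by (auto simp: D_def upper_triangular_def intro!: zero)
  then have "char_poly D = (\<Prod>a \<leftarrow> diag_mat D. [:- a, 1:])"
    by (rule char_poly_upper_triangular[rotated]) (auto simp: D_def)
  also have "\<dots> = (\<Prod>i = 0..<n - k. [:- (T $$ (i + k, i + k)), 1:])"
    by (simp add: diag_mat_def D_def prod.list_conv_set_nth)
  also have "\<dots> = (\<Prod>i = k..<n. [:- (T $$ (i, i)), 1:])"
    using \<open>k \<le> n\<close> prod.shift_bounds_nat_ivl[of "\<lambda>i. [:- (T $$ (i, i)), 1:]" 0 k "n - k"]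
    by simp
  finally show ?thesis
    by (subst blocks, subst char_poly_four_block_lower_left_zero) (auto simp: B_def D_def)
qed

text \<open>
  The indices form a forest: those below \<open>k\<close> are roots, any other \<open>a\<close> has the parent \<open>f a\<close>, and
  \<open>S c b\<close> says that \<open>b\<close> lies in the subtree of \<open>c\<close>.  The rows \<open>e\<^sub>a - e\<^bsub>f a\<^esub>\<close> (or \<open>e\<^sub>a\<close> at a root) form a
  matrix \<open>P\<close>.  Telescoping along the path from \<open>b\<close> to its root shows that \<open>e\<^sub>b\<close> is the sum of these rows
  over the ancestors of \<open>b\<close>, so the inverse of \<open>P\<close> is the incidence matrix \<open>Q\<close> of ``\<open>b\<close> is in the subtree of
  \<open>c\<close>''.  The matrix on the right-hand side is \<open>P * M * Q\<close>.
\<close>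

lemma char_poly_forest_basis:
  fixes M :: "'a :: field mat"
  assumes M: "M \<in> carrier_mat n n"
    and parent: "\<And>a. k \<le> a \<Longrightarrow> a < n \<Longrightarrow> f a < a"
    and below: "\<And>c b. c < n \<Longrightarrow> b < n \<Longrightarrow> S c b \<longleftrightarrow> b = c \<or> k \<le> b \<and> S c (f b)"
  shows "char_poly M = char_poly (mat n n (\<lambda>(a, c).
     (\<Sum>b | b < n \<and> S c b. M $$ (a, b)) -
     (if k \<le> a then \<Sum>b | b < n \<and> S c b. M $$ (f a, b) else 0)))"
proof -
  have below_ge: "c \<le> b" if "S c b" "c < n" "b < n" for c b
    using that
  proof (induction b rule: less_induct)
    case (less b)
    then show ?case
      using below[of c b] parent[of b] by fastforce
  qed
  define P :: "'a mat" where
    "P = mat n n (\<lambda>(a, b). (if b = a then 1 else 0) - (if k \<le> a \<and> b = f a then 1 else 0))"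
  define Q :: "'a mat" where "Q = mat n n (\<lambda>(b, c). if S c b then 1 else 0)"
  have P: "P \<in> carrier_mat n n" and Q: "Q \<in> carrier_mat n n"
    by (auto simp: P_def Q_def)
  have P_mult: "(P * X) $$ (a, c) = X $$ (a, c) - (if k \<le> a then X $$ (f a, c) else 0)"
    if "X \<in> carrier_mat n n" "a < n" "c < n" for X a c
  proof -
    have "(P * X) $$ (a, c) = (\<Sum>b = 0..<n. P $$ (a, b) * X $$ (b, c))"
      using that P by (simp add: scalar_prod_def)
    also have "\<dots> = (\<Sum>b = 0..<n. (if b = a then X $$ (b, c) else 0)
        - (if b = f a then if k \<le> a then X $$ (b, c) else 0 else 0))"
      using that by (intro sum.cong) (auto simp: P_def)
    also have "\<dots> = X $$ (a, c) - (if k \<le> a then X $$ (f a, c) else 0)"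
      using that parent[of a] by (auto simp: sum_subtractf)
    finally show ?thesis .
  qed
  have mult_Q: "(X * Q) $$ (a, c) = (\<Sum>b | b < n \<and> S c b. X $$ (a, b))"
    if "X \<in> carrier_mat n n" "a < n" "c < n" for X a c
  proof -
    have "(X * Q) $$ (a, c) = (\<Sum>b = 0..<n. X $$ (a, b) * Q $$ (b, c))"
      using that Q by (simp add: scalar_prod_def)
    also have "\<dots> = (\<Sum>b = 0..<n. if S c b then X $$ (a, b) else 0)"
      using that by (intro sum.cong) (auto simp: Q_def)
    also have "\<dots> = (\<Sum>b | b < n \<and> S c b. X $$ (a, b))"
      by (simp add: sum.inter_filter[symmetric])
    finally show ?thesis .
  qed
  have PQ: "P * Q = 1\<^sub>m n"
  proof (rule eq_matI)
    fix a c assume ac: "a < dim_row (1\<^sub>m n :: 'a mat)" "c < dim_col (1\<^sub>m n :: 'a mat)"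
    have "f a < n" if "k \<le> a"
      using that ac parent[of a] by simp
    moreover have "\<not> S a (f a)" if "k \<le> a"
      using that ac parent[of a] below_ge[of a "f a"] by fastforce
    moreover have "(P * Q) $$ (a, c) = Q $$ (a, c) - (if k \<le> a then Q $$ (f a, c) else 0)"
      using ac by (intro P_mult[OF Q]) auto
    ultimately show "(P * Q) $$ (a, c) = (1\<^sub>m n :: 'a mat) $$ (a, c)"
      using ac below[of c a] by (auto simp: Q_def)
  qed (use P Q in auto)
  have QP: "Q * P = 1\<^sub>m n"
    by (rule mat_mult_left_right_inverse[OF P Q PQ])
  let ?T = "mat n n (\<lambda>(a, c). (\<Sum>b | b < n \<and> S c b. M $$ (a, b)) -
     (if k \<le> a then \<Sum>b | b < n \<and> S c b. M $$ (f a, b) else 0))"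
  have PM: "P * M \<in> carrier_mat n n"
    using P M by simp
  have "?T = P * M * Q"
  proof (rule eq_matI)
    fix a c assume "a < dim_row (P * M * Q)" "c < dim_col (P * M * Q)"
    then have ac: "a < n" "c < n" using P Q by auto
    then have "(P * M * Q) $$ (a, c) = (\<Sum>b | b < n \<and> S c b. (P * M) $$ (a, b))"
      by (rule mult_Q[OF PM])
    also have "\<dots> = (\<Sum>b | b < n \<and> S c b.
        M $$ (a, b) - (if k \<le> a then M $$ (f a, b) else 0))"
      using ac by (intro sum.cong) (auto simp: P_mult[OF M] simp del: index_mult_mat)
    finally show "?T $$ (a, c) = (P * M * Q) $$ (a, c)"
      using ac by (simp add: sum_subtractf del: index_mult_mat)
  qed (use P Q in auto)
  then have "similar_mat ?T M"
    using P Q M PQ QP unfolding similar_mat_def similar_mat_wit_def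
    by (intro exI[of _ P] exI[of _ Q]) (auto simp: Let_def)
  then show ?thesis
    by (simp add: char_poly_similar)
qed

section \<open>Sums over unions of residue classes\<close>

text \<open>
  Division with remainder identifies the index set with \<open>{..<q} \<times> K\<close>.
\<close>

lemma sum_periodic_over_residues:
  fixes g :: "nat \<Rightarrow> 'a :: comm_semiring_1"
  assumes K: "K \<subseteq> {..<p}"
  shows "(\<Sum>b | b < p * q \<and> b mod p \<in> K. g (b mod p)) = of_nat q * sum g K"
proof -
  have lt: "b div p < q" if "b < p * q" for b
    using that by (metis less_mult_imp_div_less mult.commute)
  have in_range: "p * j + r < p * q" if "r < p" "j < q" for r j
  proof -
    have "p * j + r < p * Suc j" using that by simp
    also have "\<dots> \<le> p * q" using that by (intro mult_le_mono2) simp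
    finally show ?thesis .
  qed
  have "(\<Sum>b | b < p * q \<and> b mod p \<in> K. g (b mod p)) = (\<Sum>(j, r) \<in> {..<q} \<times> K. g r)"
    by (rule sum.reindex_bij_witness[of _ "\<lambda>(j, r). p * j + r" "\<lambda>b. (b div p, b mod p)"])
      (use K lt in_range in \<open>auto dest!: subsetD\<close>)
  then show ?thesis
    by (simp add: sum.cartesian_product[symmetric])
qed

lemma card_residues:
  assumes "K \<subseteq> {..<p}"
  shows "card {b. b < p * q \<and> b mod p \<in> K} = q * card K"
  using sum_periodic_over_residues[OF assms, of "\<lambda>_. 1 :: nat" q] by simp

text \<open>
  Here \<open>r\<close> is the residue \<open>-a\<close>, the only residue whose elements \<open>b\<close> make \<open>a + b\<close> a multiple of \<open>p\<close>.
\<close>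

lemma row_sum_nonmultiples:
  fixes c :: "'a :: comm_ring_1"
  assumes K: "K \<subseteq> {..<p}" and r: "r < p" "p dvd a + r"
  shows "(\<Sum>b | b < p * q \<and> b mod p \<in> K. if p dvd a + b then 0 else c)
    = c * of_nat q * (of_nat (card K) - (if r \<in> K then 1 else 0))"
proof -
  have finK: "finite K" using K finite_subset by blast
  have dvd_iff: "p dvd a + b \<longleftrightarrow> b mod p = r" for b
  proof -
    have "p dvd a + b \<longleftrightarrow> [a + b = a + r] (mod p)"
      using r(2) by (simp add: cong_def mod_eq_0_iff_dvd)
    also have "\<dots> \<longleftrightarrow> b mod p = r"
      using r(1) by (simp add: cong_add_lcancel_nat) (simp add: cong_def)
    finally show ?thesis .
  qed
  have "(\<Sum>b | b < p * q \<and> b mod p \<in> K. if p dvd a + b then 0 else c)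
      = of_nat q * (\<Sum>k\<in>K. if k = r then 0 else c)"
    unfolding dvd_iff using sum_periodic_over_residues[OF K, of "\<lambda>k. if k = r then 0 else c" q]
    by simp
  also have "(\<Sum>k\<in>K. if k = r then 0 else c) = (\<Sum>k\<in>K. c - (if k = r then c else 0))"
    by (intro sum.cong) auto
  also have "\<dots> = c * (of_nat (card K) - (if r \<in> K then 1 else 0))"
    using finK by (simp add: sum_subtractf algebra_simps)
  finally show ?thesis by (simp add: algebra_simps)
qed

section \<open>Matrices whose entries depend on divisibility of the index sum\<close>

definition residue_sum_mat :: "nat \<Rightarrow> nat \<Rightarrow> 'a :: ring_1 \<Rightarrow> 'a \<Rightarrow> 'a \<Rightarrow> 'a mat" where
  "residue_sum_mat p n c u v = mat n n (\<lambda>(a, b).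
     (if p dvd a + b then 0 else c) + (if a = b then if p dvd a then u else v else 0))"

text \<open>
  The forest, with roots \<open>0\<close> and \<open>1\<close>.  A vertex from \<open>p\<close> on hangs below the smallest vertex of its
  residue class, a residue in the upper half below its negative, and a residue \<open>a\<close> with
  \<open>2 \<le> a \<le> p div 2\<close> below \<open>1\<close>, the representative of another orbit of \<open>r \<mapsto> -r\<close>.
\<close>

definition parent :: "nat \<Rightarrow> nat \<Rightarrow> nat" where
  "parent p a = (if p \<le> a then a mod p else if p div 2 < a then p - a else 1)"

text \<open>
  The subtree of a vertex \<open>c < p\<close> consists of full residue classes, and these are their
  residues: \<open>1\<close> collects all nonzero ones, the other orbit representatives their orbit.  Stating subtrees
  in closed form, instead of by iterating \<open>parent\<close>, makes the row sums computable; that both agree is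
  \<open>descendant_iff_parent\<close>.
\<close>

definition residues_below :: "nat \<Rightarrow> nat \<Rightarrow> nat set" where
  "residues_below p c = (if c = 0 then {0} else if c = 1 then {1..<p}
     else if c \<le> p div 2 then {c, p - c} else {c})"

definition descendant :: "nat \<Rightarrow> nat \<Rightarrow> nat \<Rightarrow> bool" where
  "descendant p c b \<longleftrightarrow> (if c < p then b mod p \<in> residues_below p c else b = c)"

lemma parent_less:
  assumes "odd p" "p \<ge> 3" "2 \<le> a"
  shows "parent p a < a"
  using assms by (auto simp: parent_def elim!: oddE intro: less_le_trans[OF mod_less_divisor])

lemma residues_below_subset:
  assumes "odd p" "p \<ge> 3" "c < p"
  shows "residues_below p c \<subseteq> {..<p}"
  using assms by (auto simp: residues_below_def)

lemma descendant_iff_parent: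
  assumes "odd p" "p \<ge> 3"
  shows "descendant p c b \<longleftrightarrow> b = c \<or> 2 \<le> b \<and> descendant p c (parent p b)"
proof -
  obtain h where h: "p = 2 * h + 1" "h \<ge> 1"
    using assms by (auto elim!: oddE)
  have pos: "0 < p" using assms by simp
  consider "p \<le> b" "c < p" | "p \<le> b" "p \<le> c" | "b < p" "p \<le> c" | "b < p" "c < p"
    by linarith
  then show ?thesis
  proof cases
    case 1
    then show ?thesis using assms by (auto simp: descendant_def parent_def)
  next
    case 2
    then have "b mod p \<noteq> c" using mod_less_divisor[OF pos, of b] by linarith
    then show ?thesis using 2 by (auto simp: descendant_def parent_def)
  next
    case 3
    then have "2 \<le> b \<Longrightarrow> parent p b < p" 
      using parent_less[OF assms, of b] by linarith
    then show ?thesis using 3 by (auto simp: descendant_def)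
  next
    case 4
    then show ?thesis
      unfolding descendant_def parent_def residues_below_def
      using h by auto
  qed
qed

text \<open>
  The quadratic factor is the characteristic polynomial of the corner, that is, of the quotient by the
  partition into multiples and nonmultiples of \<open>p\<close>; the other factors come from the three kinds of
  non-root vertices.
\<close>

lemma char_poly_residue_sum_mat:
  fixes c u v :: "'a :: field"
  assumes p: "odd p" "p \<ge> 3" and q: "q \<ge> 1"
  shows "char_poly (residue_sum_mat p (p * q) c u v) =
    [: u * (v + c * of_nat (q * (p - 2))) - c * of_nat q * (c * of_nat (q * (p - 1))),
       - (u + v + c * of_nat (q * (p - 2))), 1 :]
    * [:- u, 1:] ^ (q - 1) * [:- v, 1:] ^ ((p - 1) * (q - 1))
    * [:- (v + c * of_nat q), 1:] ^ ((p - 1) div 2)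
    * [:- (v - c * of_nat q), 1:] ^ ((p - 3) div 2)"
proof -
  obtain h where h: "p = 2 * h + 1" "h \<ge> 1"
    using p by (auto elim!: oddE)
  define n where "n = p * q"
  have "p \<le> n" using q by (simp add: n_def)
  define M where "M = residue_sum_mat p n c u v"
  define d where "d a = (if p dvd a then u else v)" for a
  define w where "w a b = (if p dvd a + b then 0 else c)" for a b
  have M: "M \<in> carrier_mat n n"
    by (simp add: M_def residue_sum_mat_def)
  have M_entry: "M $$ (a, b) = w a b + (if a = b then d a else 0)" if "a < n" "b < n" for a b
    using that by (simp add: M_def residue_sum_mat_def w_def d_def)
  define R where "R a k = (\<Sum>b | b < n \<and> descendant p k b. M $$ (a, b))" for a k
  have R: "R a k = (\<Sum>b | b < n \<and> descendant p k b. w a b) + (if descendant p k a then d a else 0)"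
    if "a < n" for a k
  proof -
    have "R a k = (\<Sum>b | b < n \<and> descendant p k b. w a b + (if a = b then d a else 0))"
      unfolding R_def using that by (intro sum.cong) (auto simp: M_entry)
    then show ?thesis using that by (simp add: sum.distrib)
  qed
  have R_class: "R a k = c * of_nat q * (of_nat (card (residues_below p k))
        - (if r \<in> residues_below p k then 1 else 0)) + (if descendant p k a then d a else 0)"
    if "a < n" "k < p" "r < p" "p dvd a + r" for a k r
    using row_sum_nonmultiples[OF residues_below_subset[OF p \<open>k < p\<close>] that(3,4), where q = q and c = c] that
    by (simp add: R w_def descendant_def n_def)
  define T where "T a k = R a k - (if 2 \<le> a then R (parent p a) k else 0)" for a k
  have char_poly_T: "char_poly M = char_poly (mat n n (\<lambda>(a, k). T a k))"
    unfolding T_def R_def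
    by (rule char_poly_forest_basis[OF M])
      (rule parent_less[OF p] descendant_iff_parent[OF p] | assumption)+
  \<comment> \<open>Rows \<open>a\<close> and \<open>a mod p\<close> agree up to their diagonal corrections, so only these survive,
    and they cancel unless the subtree separates \<open>a\<close> from its parent.\<close>
  have T_twin: "T a k = (if k = a then d a else 0)" if "p \<le> a" "a < n" for a k
  proof -
    have "parent p a = a mod p"
      using that by (simp add: parent_def)
    moreover have "a mod p < n"
      using mod_less_eq_dividend that(2) by (rule le_less_trans)
    moreover have "w (a mod p) b = w a b" for b
      unfolding w_def by (simp add: dvd_eq_mod_eq_0 mod_simps)
    moreover have "d (a mod p) = d a"
      by (simp add: d_def dvd_mod_iff)
    moreover have "a mod p < p" using p by simp
    then have "a mod p \<noteq> a" using that(1) by linarith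
    then have "\<not> descendant p a (a mod p)"
      using that by (simp add: descendant_def)
    ultimately show ?thesis
      using that p descendant_iff_parent[OF p, of k a] by (auto simp: T_def R)
  qed
  have R_unit: "R a k = c * of_nat q * (of_nat (card (residues_below p k))
        - (if p - a \<in> residues_below p k then 1 else 0)) + (if a \<in> residues_below p k then v else 0)"
    if "0 < a" "a < p" "k < p" for a k
    using that \<open>p \<le> n\<close> R_class[of a k "p - a"] by (auto simp: d_def descendant_def dest: dvd_imp_le)
  \<comment> \<open>The next two facts compare the row sums of a residue and its parent: the number of residues cancels,
    and what is left is which of the two residues and which of their negatives lie in the subtree.\<close>
  have T_anti: "T a k = (if k = a then v + c * of_nat q else 0)" if "h < a" "a < p" "k \<le> a" for a k
  proof -
    have "parent p a = p - a" "2 \<le> a" using that h by (auto simp: parent_def)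
    moreover have "a \<in> residues_below p k \<longleftrightarrow> k = a \<or> p - a \<in> residues_below p k"
      "p - a \<notin> residues_below p a"
      using that h by (auto simp: residues_below_def)
    ultimately show ?thesis
      using that by (auto simp: T_def R_unit algebra_simps)
  qed
  have T_sym: "T a k = (if k = a then v - c * of_nat q else 0)" if "2 \<le> a" "a \<le> h" "k \<le> a" for a k
  proof -
    have "parent p a = 1" using that h by (auto simp: parent_def)
    moreover have "p - 1 \<in> residues_below p k \<longleftrightarrow> p - a \<in> residues_below p k \<and> k \<noteq> a"
      "1 \<in> residues_below p k \<longleftrightarrow> a \<in> residues_below p k \<and> k \<noteq> a"
      "a \<in> residues_below p a" "p - a \<in> residues_below p a"
      using that h by (auto simp: residues_below_def)
    ultimately show ?thesis
      using that h by (auto simp: T_def R_unit algebra_simps)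
  qed
  have corner: "T 0 0 = u" "T 0 1 = c * of_nat (q * (p - 1))" "T 1 0 = c * of_nat q"
    "T 1 1 = v + c * of_nat (q * (p - 2))"
    using R_class[of 0 0 0] R_class[of 0 1 0] R_unit[of 1 0] R_unit[of 1 1] h \<open>p \<le> n\<close>
    by (auto simp: T_def d_def descendant_def residues_below_def algebra_simps)
  have "char_poly M = char_poly (mat 2 2 (\<lambda>(a, k). T a k)) * (\<Prod>a = 2..<n. [:- T a a, 1:])"
  proof -
    have zero: "T a k = 0" if "2 \<le> a" "a < n" "k < a" for a k
      using that T_twin[of a k] T_anti[of a k] T_sym[of a k] by (cases "p \<le> a"; cases "h < a") auto
    have "2 \<le> n" using \<open>p \<le> n\<close> p by simp
    have "mat 2 2 (($$) (mat n n (\<lambda>(a, k). T a k))) = mat 2 2 (\<lambda>(a, k). T a k)"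
      by (rule eq_matI) (use \<open>2 \<le> n\<close> in auto)
    then show ?thesis
      using char_poly_upper_triangular_below_corner[of "mat n n (\<lambda>(a, k). T a k)" n 2] zero \<open>2 \<le> n\<close>
      by (simp add: char_poly_T)
  qed
  moreover have "char_poly (mat 2 2 (\<lambda>(a, k). T a k))
      = [: T 0 0 * T 1 1 - T 0 1 * T 1 0, - (T 0 0 + T 1 1), 1 :]"
    by (subst char_poly_2x2) auto
  moreover have "(\<Prod>a = 2..<n. [:- T a a, 1:]) = [:- (v - c * of_nat q), 1:] ^ ((p - 3) div 2)
      * [:- (v + c * of_nat q), 1:] ^ ((p - 1) div 2)
      * ([:- u, 1:] ^ (q - 1) * [:- v, 1:] ^ ((p - 1) * (q - 1)))"
  proof -
    have "(\<Prod>a = 2..<n. [:- T a a, 1:]) = (\<Prod>a = 2..<h+1. [:- T a a, 1:])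
        * (\<Prod>a = h+1..<p. [:- T a a, 1:]) * (\<Prod>a = p..<n. [:- T a a, 1:])"
      using h \<open>p \<le> n\<close> by (simp add: prod.atLeastLessThan_concat del: prod.op_ivl_Suc)
    moreover have "(\<Prod>a = 2..<h+1. [:- T a a, 1:]) = [:- (v - c * of_nat q), 1:] ^ (h - 1)"
      by (simp add: T_sym)
    moreover have "(\<Prod>a = h+1..<p. [:- T a a, 1:]) = [:- (v + c * of_nat q), 1:] ^ h"
      using h by (simp add: T_anti)
    moreover have "(\<Prod>a = p..<n. [:- T a a, 1:])
        = [:- u, 1:] ^ (q - 1) * [:- v, 1:] ^ ((p - 1) * (q - 1))"
    proof -
      have mult: "{a \<in> {p..<n}. p dvd a} = {b. b < p * q \<and> b mod p \<in> {0}} - {0}"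
        by (auto simp: n_def mod_eq_0_iff_dvd dvd_imp_le)
      have non: "{a \<in> {p..<n}. \<not> p dvd a} = {b. b < p * q \<and> b mod p \<in> {1..<p}} - {1..<p}"
        using h by (auto simp: n_def dvd_eq_mod_eq_0)
      have "card {a \<in> {p..<n}. p dvd a} = q - 1"
        unfolding mult using card_residues[of "{0}" p q] h q by (subst card_Diff_subset) auto
      moreover have "card {a \<in> {p..<n}. \<not> p dvd a} = (p - 1) * (q - 1)"
      proof -
        have "{1..<p} \<subseteq> {..<p}" by auto
        from card_residues[OF this, of q] show ?thesis
          unfolding non using \<open>p \<le> n\<close>
          by (subst card_Diff_subset)
            (auto simp: n_def diff_mult_distrib2 mult.commute intro: less_le_trans)
      qed
      moreover have "(\<Prod>a = p..<n. [:- T a a, 1:]) = (\<Prod>a = p..<n. if p dvd a then [:- u, 1:] else [:- v, 1:])"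
        by (intro prod.cong) (auto simp: T_twin d_def)
      ultimately show ?thesis
        by (simp add: prod.If_cases Int_def conj_commute)
    qed
    moreover have "(p - 3) div 2 = h - 1" "(p - 1) div 2 = h" using h by presburger+
    ultimately show ?thesis by simp
  qed
  ultimately show ?thesis
    by (simp only: corner M_def n_def mult_ac add_ac)
qed

section \<open>The spectrum of the unitary addition Cayley graph\<close>

text \<open>
  A vertex \<open>a\<close> has \<open>n - q\<close> vertices \<open>b\<close> for which \<open>p\<close> does not divide \<open>a + b\<close>.  As \<open>p\<close> is odd, \<open>a\<close>
  itself is among them iff \<open>p\<close> does not divide \<open>a\<close>, and then the missing loop lowers the degree by one.
  The loop costs \<open>\<alpha>\<close> in the degree and \<open>1 - \<alpha>\<close> in the adjacency part, hence \<open>1\<close> in total.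
\<close>

lemma A_alpha_mat_unitary_addition_Cayley_graph:
  assumes p: "prime p" "odd p" and m: "m \<ge> 1" and n: "n = p ^ m" and q: "q = p ^ (m - 1)"
  shows "A_alpha_mat \<alpha> (unitary_addition_Cayley_graph n) =
    residue_sum_mat p n (1 - \<alpha>) (\<alpha> * (real n - real q)) (\<alpha> * (real n - real q) - 1)"
proof -
  let ?G = "unitary_addition_Cayley_graph n"
  have npq: "n = p * q" using m by (simp add: n q power_eq_if)
  have "p > 0" using p(1) prime_gt_0_nat by blast
  have gcd_iff: "gcd (a + b) n = 1 \<longleftrightarrow> \<not> p dvd a + b" for a b
  proof -
    have "gcd (a + b) n = 1 \<longleftrightarrow> coprime (a + b) p"
      unfolding n coprime_iff_gcd_eq_1[symmetric] using m by simp
    also have "\<dots> \<longleftrightarrow> \<not> p dvd a + b"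
      using p(1) by (metis coprime_commute coprime_absorb_left not_prime_unit prime_imp_coprime)
    finally show ?thesis .
  qed
  have arcs_iff: "(a, b) \<in> parcs ?G \<longleftrightarrow> a < n \<and> b < n \<and> a \<noteq> b \<and> \<not> p dvd a + b" for a b
    unfolding unitary_addition_Cayley_graph_def by (simp add: gcd_iff del: One_nat_def)
  have verts: "pverts ?G = {0..<n}"
    by (simp add: unitary_addition_Cayley_graph_def)
  have double: "p dvd a + a \<longleftrightarrow> p dvd a" for a
  proof -
    have "\<not> p dvd 2" using p by (metis primes_dvd_imp_eq two_is_prime_nat dvd_refl)
    then show ?thesis using p(1) by (simp add: mult_2[symmetric] prime_dvd_mult_iff)
  qed
  have degree: "real (out_degree (with_proj ?G) a)
      = real n - real q - (if p dvd a then 0 else 1)" if "a < n" for a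
  proof -
    define r where "r = a * (p - 1) mod p"
    have "(a + r) mod p = (a + a * (p - 1)) mod p"
      unfolding r_def by (rule mod_add_right_eq)
    also have "a + a * (p - 1) = a * p"
      using \<open>p > 0\<close> by (cases p) simp_all
    finally have r: "r < p" "p dvd a + r"
      using \<open>p > 0\<close> by (simp_all add: r_def dvd_eq_mod_eq_0)
    have "out_arcs (with_proj ?G) a = Pair a ` ({b. b < n \<and> \<not> p dvd a + b} - {a})"
      using that by (auto simp: out_arcs_def arcs_iff)
    then have "out_degree (with_proj ?G) a = card ({b. b < n \<and> \<not> p dvd a + b} - {a})"
      by (simp add: out_degree_def card_image inj_on_def)
    then have "real (out_degree (with_proj ?G) a)
        = real (card {b. b < n \<and> \<not> p dvd a + b}) - (if p dvd a then 0 else 1)"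
      using that double[of a] card_gt_0_iff[of "{b. b < n \<and> \<not> p dvd a + b}"]
      by (auto simp: card_Diff_singleton_if of_nat_diff Suc_le_eq)
    also have "real (card {b. b < n \<and> \<not> p dvd a + b})
        = (\<Sum>b | b < p * q \<and> b mod p \<in> {..<p}. if p dvd a + b then 0 else 1)"
      using \<open>p > 0\<close> by (simp add: npq sum.If_cases Int_def conj_commute)
    also have "\<dots> = real n - real q"
      using r row_sum_nonmultiples[of "{..<p}" p r a "1 :: real" q] by (simp add: npq algebra_simps)
    finally show ?thesis .
  qed
  show ?thesis
  proof (rule eq_matI)
    fix a b
    assume "a < dim_row (residue_sum_mat p n (1 - \<alpha>) (\<alpha> * (real n - real q)) (\<alpha> * (real n - real q) - 1))"
      "b < dim_col (residue_sum_mat p n (1 - \<alpha>) (\<alpha> * (real n - real q)) (\<alpha> * (real n - real q) - 1))"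
    then have "a < n" "b < n" by (auto simp: residue_sum_mat_def)
    then show "A_alpha_mat \<alpha> ?G $$ (a, b) =
      residue_sum_mat p n (1 - \<alpha>) (\<alpha> * (real n - real q)) (\<alpha> * (real n - real q) - 1) $$ (a, b)"
      using double[of a]
      by (auto simp: degree A_alpha_mat_def degree_mat_def adjacency_mat_def residue_sum_mat_def
          verts arcs_iff algebra_simps)
  qed (auto simp: A_alpha_mat_def degree_mat_def adjacency_mat_def residue_sum_mat_def verts)
qed

lemma proots_linear_power:
  fixes a :: "'a :: idom"
  shows "proots ([:- a, 1:] ^ k) = replicate_mset k a"
  by (simp add: proots_power)

lemma quadratic_poly_factorization:
  fixes s t y :: real
  assumes "y\<^sup>2 = s\<^sup>2 - 4 * t"
  shows "[: t, - s, 1 :] = [:- ((s - y) / 2), 1:] * [:- ((s + y) / 2), 1:]"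
  using assms by (simp add: field_simps power2_eq_square)

theorem proposition3p1:
  fixes p m n :: nat and \<alpha> x y :: real
  assumes "prime p" and "p \<ge> 3" and "m \<ge> 1" and "n = p ^ m"
    and "0 \<le> \<alpha>" and "\<alpha> \<le> 1"
    and "x = (1 + \<alpha>) * real p ^ m - 2 * real p ^ (m - 1) - 1"
    and "y = sqrt ((1 - real p ^ m + \<alpha> * real p ^ m)\<^sup>2 + 4 * (1 - \<alpha>) * real p ^ (m - 1))"
  shows "A_alpha_spectrum \<alpha> (unitary_addition_Cayley_graph n) =
      replicate_mset ((p - 3) div 2) (real p ^ (m - 1) * (real p * \<alpha> - 1) - 1)
    + replicate_mset 1 ((x - y) / 2)
    + replicate_mset ((p - 1) * (p ^ (m - 1) - 1)) (real p ^ (m - 1) * (real p - 1) * \<alpha> - 1)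
    + replicate_mset (p ^ (m - 1) - 1) (\<alpha> * (real p ^ m - real p ^ (m - 1)))
    + replicate_mset ((p - 1) div 2) (real p ^ (m - 1) * ((real p - 2) * \<alpha> + 1) - 1)
    + replicate_mset 1 ((x + y) / 2)"
proof -
  define q where "q = p ^ (m - 1)"
  define u where "u = \<alpha> * (real n - real q)"
  define c where "c = 1 - \<alpha>"
  have npq: "n = p * q" using \<open>m \<ge> 1\<close> \<open>n = p ^ m\<close> by (simp add: q_def power_eq_if)
  have real_q: "real p ^ (m - 1) = real q" and real_n: "real p ^ m = real p * real q"
    using npq \<open>n = p ^ m\<close> by (simp_all add: q_def flip: of_nat_power of_nat_mult)
  have "odd p" using assms(1,2) prime_odd_nat by auto
  have "q \<ge> 1" using \<open>p \<ge> 3\<close> by (simp add: q_def)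
  have real_diffs: "real (q * (p - 2)) = real q * (real p - 2)" "real (q * (p - 1)) = real q * (real p - 1)"
    using \<open>p \<ge> 3\<close> by (simp_all add: of_nat_diff)
  let ?s = "u + (u - 1) + c * real (q * (p - 2))"
  let ?t = "u * ((u - 1) + c * real (q * (p - 2))) - c * real q * (c * real (q * (p - 1)))"
  have x: "?s = x"
    unfolding assms(7) real_n real_q u_def c_def npq real_diffs by (simp add: algebra_simps)
  have "y\<^sup>2 = (1 - real p * real q + \<alpha> * (real p * real q))\<^sup>2 + 4 * (1 - \<alpha>) * real q"
    unfolding assms(8) real_n real_q using \<open>\<alpha> \<le> 1\<close> by (intro real_sqrt_pow2) simp
  then have "y\<^sup>2 = ?s\<^sup>2 - 4 * ?t"
    unfolding u_def c_def npq real_diffs by (simp add: power2_eq_square algebra_simps)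
  then have quad: "[: ?t, - ?s, 1 :] = [:- ((x - y) / 2), 1:] * [:- ((x + y) / 2), 1:]"
    using quadratic_poly_factorization[of y ?s ?t] unfolding x by simp
  have "char_poly (A_alpha_mat \<alpha> (unitary_addition_Cayley_graph n))
      = [:- ((x - y) / 2), 1:] * [:- ((x + y) / 2), 1:]
        * [:- u, 1:] ^ (q - 1) * [:- (u - 1), 1:] ^ ((p - 1) * (q - 1))
        * [:- (u - 1 + c * real q), 1:] ^ ((p - 1) div 2)
        * [:- (u - 1 - c * real q), 1:] ^ ((p - 3) div 2)"
    using char_poly_residue_sum_mat[OF \<open>odd p\<close> \<open>p \<ge> 3\<close> \<open>q \<ge> 1\<close>, of c u "u - 1"]
      A_alpha_mat_unitary_addition_Cayley_graph[OF \<open>prime p\<close> \<open>odd p\<close> \<open>m \<ge> 1\<close> \<open>n = p ^ m\<close> q_def, of \<alpha>]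
    unfolding quad u_def[symmetric] c_def[symmetric] npq[symmetric] by simp
  then have "A_alpha_spectrum \<alpha> (unitary_addition_Cayley_graph n)
      = {#(x - y) / 2#} + {#(x + y) / 2#} + replicate_mset (q - 1) u
        + replicate_mset ((p - 1) * (q - 1)) (u - 1)
        + replicate_mset ((p - 1) div 2) (u - 1 + c * real q)
        + replicate_mset ((p - 3) div 2) (u - 1 - c * real q)"
    unfolding A_alpha_spectrum_def
    by (simp only: proots_mult proots_linear_power proots_linear_factor minus_minus
      mult_eq_0_iff power_eq_0_iff pCons_eq_0_iff one_neq_zero simp_thms)
  moreover have eigenvalue_eqs: "real q * (real p - 1) * \<alpha> - 1 = u - 1"
    "real q * ((real p - 2) * \<alpha> + 1) - 1 = u - 1 + c * real q"
    "real q * (real p * \<alpha> - 1) - 1 = u - 1 - c * real q"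
    "\<alpha> * (real p * real q - real q) = u"
    by (simp_all add: u_def c_def npq algebra_simps)
  moreover have "replicate_mset 1 z = {#z#}" for z :: real by simp
  ultimately show ?thesis
    unfolding real_q real_n q_def[symmetric] eigenvalue_eqs by (simp only: ac_simps)
qed

end
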